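(* A basic sequence in a Banach space is unconditional if and only if it is both RUC and RUD.
   Context: A series $\sum_n x_n$ in a Banach space is randomly unconditionally convergent if $\sum_n \varepsilon_n x_n$ converges for almost every $(\varepsilon_n)_n\in\{-1,1\}^{\mathbb N}$ with respect to the Haar probability measure. A (Schauder) basic sequence $(x_n)_n$ is RUC if every convergent series $\sum_n a_nx_n$ ($a_n$ scalars) is randomly unconditionally convergent. It is RUD if, whenever $\sum_n a_nx_n$ is randomly unconditionally convergent, the series $\sum_n a_nx_n$ converges. It is unconditional if every convergent series $\sum_n a_nx_n$ converges unconditionally. *)

theory Defs
  imports "HOL-Probability.Probability"
begin

text \<open>
  The library's Banach spaces are real.  To cover real and complex Banach spaces at once, the
  scalar multiplication is a parameter over a scalar field of class \<open>real_normed_field\<close>; by the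
  Gelfand--Mazur theorem the only such fields are, up to isometric isomorphism, the reals and the
  complex numbers.  The metric, the topology and completeness come from the class \<open>banach\<close>.
\<close>

locale banach_space_over = vector_space smul
  for smul :: "'k::real_normed_field \<Rightarrow> 'a::banach \<Rightarrow> 'a" +
  assumes smul_of_real: "smul (of_real r) v = r *\<^sub>R v"
    and norm_smul: "norm (smul c v) = norm c * norm v"

lemma banach_space_over_real:
  "banach_space_over (scaleR :: real \<Rightarrow> 'a::banach \<Rightarrow> 'a)"
  by unfold_locales (simp_all add: algebra_simps)

lemma banach_space_over_complex:
  "banach_space_over ((*) :: complex \<Rightarrow> complex \<Rightarrow> complex)"
  by unfold_locales (simp_all add: algebra_simps norm_mult scaleR_conv_of_real)

text \<open>A basic sequence is a Schauder basis of its closed linear span.\<close>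

definition basic_sequence ::
  "('k::real_normed_field \<Rightarrow> 'a::banach \<Rightarrow> 'a) \<Rightarrow> (nat \<Rightarrow> 'a) \<Rightarrow> bool" where
  "basic_sequence smul x \<longleftrightarrow>
     (\<forall>y \<in> closure (module.span smul (range x)). \<exists>!a. (\<lambda>n. smul (a n) (x n)) sums y)"

definition unconditionally_convergent :: "(nat \<Rightarrow> 'a::banach) \<Rightarrow> bool" where
  "unconditionally_convergent y \<longleftrightarrow> (\<forall>\<pi>. bij \<pi> \<longrightarrow> summable (\<lambda>n. y (\<pi> n)))"

text \<open>
  The Haar probability measure of the compact group \<open>{-1,1}\<^sup>\<nat>\<close> is the product of the uniform
  measures on the factors; the lemmas below show that it is a probability measure
  invariant under translations.  As there are countably many factors, the product
  \<open>\<sigma>\<close>-algebra is the Borel \<open>\<sigma>\<close>-algebra of the product topology.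
\<close>

definition sign_measure :: "(nat \<Rightarrow> real) measure" where
  "sign_measure = (\<Pi>\<^sub>M n\<in>UNIV. uniform_count_measure {-1, 1})"

lemma space_sign_measure: "space sign_measure = {\<epsilon>. \<forall>n. \<epsilon> n \<in> {-1, 1}}"
  by (auto simp: sign_measure_def space_PiM space_uniform_count_measure)

lemma prob_space_sign_measure: "prob_space sign_measure"
  unfolding sign_measure_def
  by (intro prob_space_PiM prob_space_uniform_count_measure) auto

lemma distr_sign_measure_translate:
  assumes "\<theta> \<in> space sign_measure"
  shows "distr sign_measure sign_measure (\<lambda>\<epsilon> n. \<theta> n * \<epsilon> n) = sign_measure"
proof -
  let ?U = "uniform_count_measure {-1, 1::real}"
  let ?t = "\<lambda>\<epsilon> n. \<theta> n * \<epsilon> n"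
  have \<theta>: "\<theta> n = -1 \<or> \<theta> n = 1" for n
    using assms by (auto simp: space_sign_measure)
  have \<theta>_mult: "\<theta> n * s \<in> {-1, 1} \<longleftrightarrow> s \<in> {-1, 1}" for n s
    using \<theta>[of n] by auto
  have U: "prob_space ?U"
    by (intro prob_space_uniform_count_measure) auto
  have factor: "(\<lambda>s. \<theta> n * s) \<in> ?U \<rightarrow>\<^sub>M ?U" for n
    using \<theta>[of n] by (auto simp: measurable_def space_uniform_count_measure sets_uniform_count_measure)
  have meas: "?t \<in> sign_measure \<rightarrow>\<^sub>M sign_measure"
    unfolding sign_measure_def
  proof (rule measurable_PiM_single')
    show "(\<lambda>\<epsilon>. \<theta> n * \<epsilon> n) \<in> (\<Pi>\<^sub>M n\<in>UNIV. ?U) \<rightarrow>\<^sub>M ?U" for n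
      by (rule measurable_compose[OF _ factor]) simp
    show "?t \<in> space (\<Pi>\<^sub>M n\<in>UNIV. ?U) \<rightarrow> (\<Pi>\<^sub>E n\<in>UNIV. space ?U)"
      using \<theta>_mult by (auto simp: space_PiM space_uniform_count_measure PiE_iff simp del: insert_iff)
  qed
  have "sign_measure = distr sign_measure sign_measure ?t"
  proof (rule measure_eqI_PiM_infinite[where I = UNIV and M = "\<lambda>_. ?U"])
    fix A :: "nat \<Rightarrow> real set" and J :: "nat set"
    assume J: "finite J" "J \<subseteq> UNIV" and A: "\<And>n. n \<in> J \<Longrightarrow> A n \<in> sets ?U"
    let ?B = "\<lambda>n. (\<lambda>s. \<theta> n * s) -` A n \<inter> {-1, 1}"
    have B: "?B n \<in> sets ?U" for n
      by (auto simp: sets_uniform_count_measure)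
    have "emeasure (distr sign_measure sign_measure ?t) (prod_emb UNIV (\<lambda>_. ?U) J (Pi\<^sub>E J A)) =
        emeasure sign_measure (?t -` prod_emb UNIV (\<lambda>_. ?U) J (Pi\<^sub>E J A) \<inter> space sign_measure)"
      using A J by (intro emeasure_distr meas) (auto simp: sign_measure_def intro!: sets_PiM_I)
    also have "?t -` prod_emb UNIV (\<lambda>_. ?U) J (Pi\<^sub>E J A) \<inter> space sign_measure =
        prod_emb UNIV (\<lambda>_. ?U) J (Pi\<^sub>E J ?B)"
      using \<theta>_mult by (auto simp: prod_emb_def space_sign_measure space_uniform_count_measure
          PiE_iff simp del: insert_iff)
    also have "emeasure sign_measure \<dots> = (\<Prod>n\<in>J. emeasure ?U (?B n))"
      unfolding sign_measure_def using J B U by (intro emeasure_PiM_emb) auto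
    also have "\<dots> = (\<Prod>n\<in>J. emeasure ?U (A n))"
    proof (rule prod.cong[OF refl])
      fix n assume "n \<in> J"
      then have sub: "A n \<subseteq> {-1, 1}"
        using A by (auto simp: sets_uniform_count_measure)
      have "bij_betw (\<lambda>s. \<theta> n * s) (?B n) (A n)"
        using \<theta>[of n] sub by (intro bij_betwI[where g = "\<lambda>s. \<theta> n * s"]) auto
      then have "card (?B n) = card (A n)"
        by (rule bij_betw_same_card)
      then show "emeasure ?U (?B n) = emeasure ?U (A n)"
        using sub by (simp add: emeasure_uniform_count_measure)
    qed
    also have "\<dots> = emeasure sign_measure (prod_emb UNIV (\<lambda>_. ?U) J (Pi\<^sub>E J A))"
      unfolding sign_measure_def using J A U by (intro emeasure_PiM_emb[symmetric]) auto
    finally show "emeasure sign_measure (prod_emb UNIV (\<lambda>_. ?U) J (Pi\<^sub>E J A)) =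
        emeasure (distr sign_measure sign_measure ?t) (prod_emb UNIV (\<lambda>_. ?U) J (Pi\<^sub>E J A))" ..
  next
    show "finite_measure sign_measure"
      using prob_space_sign_measure by (simp add: prob_space_def)
  qed (simp_all add: sign_measure_def)
  then show ?thesis ..
qed

definition randomly_unconditionally_convergent :: "(nat \<Rightarrow> 'a::banach) \<Rightarrow> bool" where
  "randomly_unconditionally_convergent y \<longleftrightarrow>
     (AE \<epsilon> in sign_measure. summable (\<lambda>n. \<epsilon> n *\<^sub>R y n))"

text \<open>The next three predicates are meant for sequences that are basic.\<close>

definition unconditional ::
  "('k::real_normed_field \<Rightarrow> 'a::banach \<Rightarrow> 'a) \<Rightarrow> (nat \<Rightarrow> 'a) \<Rightarrow> bool" where
  "unconditional smul x \<longleftrightarrow>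
     (\<forall>a. summable (\<lambda>n. smul (a n) (x n)) \<longrightarrow>
          unconditionally_convergent (\<lambda>n. smul (a n) (x n)))"

definition RUC ::
  "('k::real_normed_field \<Rightarrow> 'a::banach \<Rightarrow> 'a) \<Rightarrow> (nat \<Rightarrow> 'a) \<Rightarrow> bool" where
  "RUC smul x \<longleftrightarrow>
     (\<forall>a. summable (\<lambda>n. smul (a n) (x n)) \<longrightarrow>
          randomly_unconditionally_convergent (\<lambda>n. smul (a n) (x n)))"

definition RUD ::
  "('k::real_normed_field \<Rightarrow> 'a::banach \<Rightarrow> 'a) \<Rightarrow> (nat \<Rightarrow> 'a) \<Rightarrow> bool" where
  "RUD smul x \<longleftrightarrow>
     (\<forall>a. randomly_unconditionally_convergent (\<lambda>n. smul (a n) (x n)) \<longrightarrow>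
          summable (\<lambda>n. smul (a n) (x n)))"

end

theory Submission
  imports Defs
begin

text \<open>
  Everything rests on one classical fact about series in a Banach space: all rearrangements of
  \<open>\<Sum>y\<^sub>n\<close> converge if and only if \<open>\<Sum>\<theta>\<^sub>n y\<^sub>n\<close> converges for every choice of signs
  \<open>\<theta>\<close> (\<open>unconditionally_convergent_iff_all_signs\<close>).  Both conditions are compared with summability
  along the net of finite index sets.  If that fails, the Cauchy criterion yields consecutive
  intervals of indices, each containing a finite set \<open>F\<^sub>k\<close> whose partial sum is bounded away
  from \<open>0\<close>.  A rearrangement that lists \<open>F\<^sub>k\<close> at the start of the \<open>k\<close>-th interval diverges, and so
  does one of the series \<open>\<Sum>y\<^sub>n\<close> and \<open>\<Sum>\<theta>\<^sub>n y\<^sub>n\<close>, where \<open>\<theta>\<close> is \<open>1\<close> on the sets \<open>F\<^sub>k\<close> and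
  \<open>-1\<close> elsewhere.

  Given this fact, suppose that the basic sequence is unconditional.  A convergent series then
  converges for all signs, hence for almost all of them, which is RUC.  For RUD, if
  \<open>\<Sum>\<epsilon>\<^sub>n a\<^sub>n x\<^sub>n\<close> converges for almost all \<open>\<epsilon>\<close>, it converges for at least one, and
  unconditionality, applied with the coefficients \<open>\<epsilon>\<^sub>n a\<^sub>n\<close>, allows multiplying its terms by
  \<open>\<epsilon>\<^sub>n\<close> again, which restores \<open>\<Sum>a\<^sub>n x\<^sub>n\<close> because \<open>\<epsilon>\<^sub>n\<^sup>2 = 1\<close>.

  Conversely, let \<open>\<Sum>a\<^sub>n x\<^sub>n\<close> converge and let \<open>\<theta>\<close> be any signs.  By RUC,
  \<open>\<Sum>\<epsilon>\<^sub>n a\<^sub>n x\<^sub>n\<close> converges for almost all \<open>\<epsilon>\<close>.  The Haar measure is invariant under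
  translation by \<open>\<theta>\<close>, so \<open>\<Sum>\<epsilon>\<^sub>n \<theta>\<^sub>n a\<^sub>n x\<^sub>n\<close> converges for almost all \<open>\<epsilon>\<close> as well
  (\<open>randomly_unconditionally_convergent_sign_change\<close>), and RUD makes \<open>\<Sum>\<theta>\<^sub>n a\<^sub>n x\<^sub>n\<close> converge.
\<close>

section \<open>Unconditional convergence and changes of sign\<close>

text \<open>
  The Cauchy criterion for the net of finite sets: the sums over any two finite supersets of
  \<open>{..<N}\<close> differ from the sum over \<open>{..<N}\<close> by sums over finite subsets of \<open>{N..}\<close>.
\<close>

lemma summable_on_nat_if_tails_small:
  fixes y :: "nat \<Rightarrow> 'a::banach"
  assumes small: "\<And>e. e > 0 \<Longrightarrow> \<exists>N. \<forall>F. finite F \<and> F \<subseteq> {N..} \<longrightarrow> norm (sum y F) < e"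
  shows "y summable_on UNIV"
proof -
  have "\<exists>P. eventually P (finite_subsets_at_top UNIV) \<and>
            (\<forall>F F'. P F \<and> P F' \<longrightarrow> dist (sum y F) (sum y F') < e)" if e: "e > 0" for e
  proof -
    obtain N where N: "\<And>F. finite F \<Longrightarrow> F \<subseteq> {N..} \<Longrightarrow> norm (sum y F) < e / 2"
      using small[of "e / 2"] e by auto
    let ?P = "\<lambda>F. finite F \<and> {..<N} \<subseteq> F"
    have near: "dist (sum y F) (sum y {..<N}) < e / 2" if "?P F" for F
    proof -
      have "sum y F - sum y {..<N} = sum y (F - {..<N})"
        using that by (simp add: sum_diff)
      then show ?thesis
        using N[of "F - {..<N}"] that by (simp add: dist_norm subset_iff not_less)
    qed
    have "eventually ?P (finite_subsets_at_top UNIV)"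
      by (auto simp: eventually_finite_subsets_at_top intro!: exI[of _ "{..<N}"])
    moreover have "dist (sum y F) (sum y F') < e" if "?P F" "?P F'" for F F'
      using near[OF that(1)] near[OF that(2)] by (rule dist_triangle_half_l)
    ultimately show ?thesis
      by (intro exI[of _ ?P]) blast
  qed
  then have "cauchy_filter (filtermap (sum y) (finite_subsets_at_top UNIV))"
    by (simp add: cauchy_filter_metric_filtermap)
  moreover have "uniform_space_class.complete (UNIV :: 'a set)"
    by (meson Cauchy_convergent UNIV_I complete_def convergent_def)
  ultimately obtain s where "(sum y \<longlongrightarrow> s) (finite_subsets_at_top UNIV)"
    using complete_uniform[where S = UNIV] by (force simp: filterlim_def)
  then show ?thesis
    by (auto simp: summable_on_def has_sum_def)
qed

text \<open>
  The failure of the Cauchy criterion, iterated: each block \<open>F\<^sub>k\<close> is found beyond the index where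
  the previous interval ends, and the next interval starts past the maximum of \<open>F\<^sub>k\<close>.
\<close>

lemma not_summable_on_nat_blocks:
  fixes y :: "nat \<Rightarrow> 'a::banach"
  assumes "\<not> y summable_on UNIV"
  obtains e N F where "e > 0" "N 0 = 0" "strict_mono (N :: nat \<Rightarrow> nat)"
    "\<And>k. F k \<subseteq> {N k..<N (Suc k)}" "\<And>k. norm (sum y (F k)) \<ge> e"
proof -
  obtain e where e: "e > 0"
    and big: "\<And>N. \<exists>F. finite F \<and> F \<subseteq> {N..} \<and> norm (sum y F) \<ge> e"
    using summable_on_nat_if_tails_small[of y] assms by (meson not_le)
  have step: "\<exists>M. N < M \<and> (\<exists>F \<subseteq> {N..<M}. norm (sum y F) \<ge> e)" for N
  proof -
    obtain F where F: "finite F" "F \<subseteq> {N..}" "norm (sum y F) \<ge> e"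
      using big by blast
    define M where "M = Suc (Max (insert N F))"
    have "n < M" if "n \<in> insert N F" for n
      using that F(1) unfolding M_def less_Suc_eq_le by (intro Max_ge) auto
    with F show ?thesis
      by (intro exI[of _ M]) (auto intro!: exI[of _ F])
  qed
  obtain N where "\<And>k. (k = 0 \<longrightarrow> N k = 0) \<and> N k < N (Suc k) \<and>
      (\<exists>F \<subseteq> {N k..<N (Suc k)}. norm (sum y F) \<ge> e)"
    using dependent_nat_choice[of "\<lambda>k m. k = 0 \<longrightarrow> m = 0"
        "\<lambda>_ m m'. m < m' \<and> (\<exists>F \<subseteq> {m..<m'}. norm (sum y F) \<ge> e)"] step
    by auto
  then have N: "N 0 = 0" "\<And>k. N k < N (Suc k)"
    "\<And>k. \<exists>F \<subseteq> {N k..<N (Suc k)}. norm (sum y F) \<ge> e"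
    by blast+
  obtain F where "\<And>k. F k \<subseteq> {N k..<N (Suc k)}" "\<And>k. norm (sum y (F k)) \<ge> e"
    using N(3) by metis
  with N e show thesis
    by (intro that[of e N F]) (auto simp: strict_mono_Suc_iff)
qed

lemma strict_mono_intervals:
  fixes N :: "nat \<Rightarrow> nat"
  assumes N: "strict_mono N" "N 0 = 0"
  shows "disjoint_family (\<lambda>k. {N k..<N (Suc k)})" "(\<Union>k. {N k..<N (Suc k)}) = UNIV"
proof -
  have "k \<le> j" if "n \<in> {N k..<N (Suc k)}" "n \<in> {N j..<N (Suc j)}" for j k n
  proof -
    have "N k < N (Suc j)"
      using that by auto
    then show ?thesis
      using N(1) by (simp add: strict_mono_less less_Suc_eq_le)
  qed
  then show "disjoint_family (\<lambda>k. {N k..<N (Suc k)})"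
    unfolding disjoint_family_on_def by (blast intro: antisym)
  have "\<exists>k. n \<in> {N k..<N (Suc k)}" for n
  proof -
    have "n < N (Suc n)"
      using strict_mono_imp_increasing[OF N(1), of "Suc n"] by simp
    then obtain k where "n < N k" "\<And>j. j < k \<Longrightarrow> \<not> n < N j"
      using exists_least_iff[of "\<lambda>k. n < N k"] by blast
    with N(2) show ?thesis
      by (cases k) (auto simp: not_less)
  qed
  then show "(\<Union>k. {N k..<N (Suc k)}) = UNIV"
    by blast
qed

text \<open>
  Each interval has a permutation moving its block to the start, and these permutations glue
  together since the intervals partition \<open>\<nat>\<close>.  The blocks thereby become runs of consecutive
  terms of the rearranged series, so their sums enter the Cauchy criterion for that series.
\<close>

lemma permutation_collecting_blocks:
  fixes N :: "nat \<Rightarrow> nat"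
  assumes N: "strict_mono N" "N 0 = 0" and F: "\<And>k. F k \<subseteq> {N k..<N (Suc k)}"
  obtains \<pi> where "bij \<pi>" "\<And>k. bij_betw \<pi> {N k..<N k + card (F k)} (F k)"
proof -
  let ?I = "\<lambda>k. {N k..<N (Suc k)}"
  let ?J = "\<lambda>k. {N k..<N k + card (F k)}"
  note disj = strict_mono_intervals(1)[OF N] and cover = strict_mono_intervals(2)[OF N]
  have J: "?J k \<subseteq> ?I k" for k
    using card_mono[OF _ F[of k]] N(1) by (auto simp: strict_mono_Suc_iff less_imp_le)
  have "\<exists>p. bij_betw p (?I k) (?I k) \<and> bij_betw p (?J k) (F k)" for k
  proof -
    have fin: "finite (F k)"
      using F finite_subset by blast
    obtain f where f: "bij_betw f (?J k) (F k)"
      using finite_same_card_bij[of "?J k" "F k"] fin by auto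
    have "card (?I k - ?J k) = card (?I k - F k)"
      using card_Diff_subset[OF _ J, of k] card_Diff_subset[OF fin F] by simp
    then obtain g where g: "bij_betw g (?I k - ?J k) (?I k - F k)"
      using finite_same_card_bij[of "?I k - ?J k" "?I k - F k"] by auto
    let ?p = "\<lambda>n. if n \<in> ?J k then f n else g n"
    have "bij_betw ?p (?J k \<union> (?I k - ?J k)) (F k \<union> (?I k - F k))"
      by (rule bij_betw_disjoint_Un[OF f g]) auto
    moreover have "?J k \<union> (?I k - ?J k) = ?I k" "F k \<union> (?I k - F k) = ?I k"
      using J F by blast+
    moreover have "bij_betw ?p (?J k) (F k)"
      using f by (subst bij_betw_cong[where g = f]) auto
    ultimately show ?thesis
      by (intro exI[of _ ?p]) simp
  qed
  then obtain p where p: "\<And>k. bij_betw (p k) (?I k) (?I k)" "\<And>k. bij_betw (p k) (?J k) (F k)"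
    by metis
  define \<pi> where "\<pi> n = p (THE k. n \<in> ?I k) n" for n
  have \<pi>: "\<pi> n = p k n" if "n \<in> ?I k" for n k
  proof -
    have "(THE k. n \<in> ?I k) = k"
      using that disj unfolding disjoint_family_on_def by (intro the_equality) blast+
    then show ?thesis
      by (simp add: \<pi>_def)
  qed
  have "bij_betw \<pi> (?I k) (?I k)" for k
    using p(1) \<pi> by (subst bij_betw_cong[where g = "p k"]) auto
  then have "bij \<pi>"
    using bij_betw_UNION_disjoint[OF disj, of \<pi> ?I] cover by simp
  moreover have "bij_betw \<pi> (?J k) (F k)" for k
    using p(2) \<pi> J by (subst bij_betw_cong[where g = "p k"]) blast+
  ultimately show thesis
    by (rule that)
qed

text \<open>
  Net summability does not depend on the order of the index set, so it passes to all rearrangements;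
  the rearrangement that collects the blocks violates the Cauchy criterion when net summability fails.
\<close>

lemma unconditionally_convergent_iff_summable_on:
  "unconditionally_convergent y \<longleftrightarrow> y summable_on UNIV"
proof
  assume y: "y summable_on UNIV"
  show "unconditionally_convergent y"
    unfolding unconditionally_convergent_def
  proof (intro allI impI)
    fix \<pi> :: "nat \<Rightarrow> nat"
    assume "bij \<pi>"
    then show "summable (\<lambda>n. y (\<pi> n))"
      using y by (intro summable_on_imp_summable) (simp add: summable_on_reindex_bij_betw)
  qed
next
  assume uc: "unconditionally_convergent y"
  show "y summable_on UNIV"
  proof (rule ccontr)
    assume "\<not> y summable_on UNIV"
    then obtain e N F where e: "e > 0" and N: "N 0 = 0" "strict_mono N"
      and F: "\<And>k. F k \<subseteq> {N k..<N (Suc k)}" and big: "\<And>k. norm (sum y (F k)) \<ge> e"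
      by (rule not_summable_on_nat_blocks) blast
    obtain \<pi> where \<pi>: "bij \<pi>" "\<And>k. bij_betw \<pi> {N k..<N k + card (F k)} (F k)"
      using permutation_collecting_blocks[OF N(2,1), of F] F by blast
    have "summable (\<lambda>n. y (\<pi> n))"
      using uc \<pi>(1) by (simp add: unconditionally_convergent_def)
    then obtain K where K: "\<And>m n. m \<ge> K \<Longrightarrow> norm (\<Sum>i=m..<n. y (\<pi> i)) < e"
      unfolding summable_Cauchy using e by blast
    have "(\<Sum>i=N K..<N K + card (F K). y (\<pi> i)) = sum y (F K)"
      using \<pi>(2) by (rule sum.reindex_bij_betw)
    then show False
      using K[of "N K" "N K + card (F K)"] big[of K] strict_mono_imp_increasing[OF N(2), of K]
      by simp
  qed
qed

text \<open>
  Summability over \<open>UNIV\<close> passes to the two sets where the sign is constant.  For the converse, the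
  block sums are \<open>\<Sum>\<^sub>n\<^sub>\<in>\<^sub>F y\<^sub>n = (\<Sum>\<^sub>n\<^sub>\<in>\<^sub>I y\<^sub>n + \<Sum>\<^sub>n\<^sub>\<in>\<^sub>I \<theta>\<^sub>n y\<^sub>n) / 2\<close>,
  where \<open>\<theta>\<close> is \<open>1\<close> on the blocks and \<open>-1\<close> off them, and \<open>I\<close> is the interval around the
  block \<open>F\<close>.
\<close>

lemma all_signs_summable_iff_summable_on:
  fixes y :: "nat \<Rightarrow> 'a::banach"
  shows "(\<forall>\<theta>\<in>space sign_measure. summable (\<lambda>n. \<theta> n *\<^sub>R y n)) \<longleftrightarrow> y summable_on UNIV"
proof
  assume y: "y summable_on UNIV"
  show "\<forall>\<theta>\<in>space sign_measure. summable (\<lambda>n. \<theta> n *\<^sub>R y n)"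
  proof
    fix \<theta> :: "nat \<Rightarrow> real"
    assume "\<theta> \<in> space sign_measure"
    then have \<theta>: "\<theta> n = -1 \<or> \<theta> n = 1" for n
      by (auto simp: space_sign_measure)
    let ?z = "\<lambda>n. \<theta> n *\<^sub>R y n" and ?P = "{n. \<theta> n = 1}"
    have "?z summable_on ?P"
      using summable_on_subset_banach[OF y, of ?P]
      by (subst summable_on_cong[where g = y]) auto
    moreover have "?z summable_on - ?P"
    proof (subst summable_on_cong)
      show "?z n = - y n" if "n \<in> - ?P" for n
        using that \<theta>[of n] by simp
      show "(\<lambda>n. - y n) summable_on - ?P"
        using summable_on_subset_banach[OF y, of "- ?P"] by (simp add: summable_on_uminus)
    qed
    ultimately have "?z summable_on ?P \<union> - ?P"
      by (rule summable_on_Un_disjoint) simp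
    then show "summable ?z"
      by (intro summable_on_imp_summable) simp
  qed
next
  assume signs: "\<forall>\<theta>\<in>space sign_measure. summable (\<lambda>n. \<theta> n *\<^sub>R y n)"
  show "y summable_on UNIV"
  proof (rule ccontr)
    assume "\<not> y summable_on UNIV"
    then obtain e N F where e: "e > 0" and N: "N 0 = 0" "strict_mono N"
      and F: "\<And>k. F k \<subseteq> {N k..<N (Suc k)}" and big: "\<And>k. norm (sum y (F k)) \<ge> e"
      by (rule not_summable_on_nat_blocks) blast
    let ?I = "\<lambda>k. {N k..<N (Suc k)}"
    define \<theta> where "\<theta> n = (if n \<in> (\<Union>k. F k) then 1 else -1 :: real)" for n
    have "summable (\<lambda>n. \<theta> n *\<^sub>R y n)" "summable (\<lambda>n. 1 *\<^sub>R y n)"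
      using signs[rule_format, of \<theta>] signs[rule_format, of "\<lambda>_. 1"]
      by (auto simp: space_sign_measure \<theta>_def)
    then have "summable (\<lambda>n. \<theta> n *\<^sub>R y n + y n)"
      by (intro summable_add) simp_all
    then obtain K where K: "\<And>m n. m \<ge> K \<Longrightarrow> norm (\<Sum>i=m..<n. \<theta> i *\<^sub>R y i + y i) < e"
      unfolding summable_Cauchy using e by blast
    have mem: "n \<in> (\<Union>k. F k) \<longleftrightarrow> n \<in> F K" if "n \<in> ?I K" for n
    proof -
      have "j = K" if "n \<in> F j" for j
        using \<open>n \<in> ?I K\<close> \<open>n \<in> F j\<close> F[of j] strict_mono_intervals(1)[OF N(2,1)]
        unfolding disjoint_family_on_def by blast
      then show ?thesis
        by blast
    qed
    have "(\<Sum>i\<in>?I K. \<theta> i *\<^sub>R y i + y i) = (\<Sum>i\<in>?I K. if i \<in> F K then 2 *\<^sub>R y i else 0)"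
      using mem by (intro sum.cong) (auto simp: \<theta>_def scaleR_2)
    also have "\<dots> = (\<Sum>i\<in>?I K \<inter> F K. 2 *\<^sub>R y i)"
      by (simp add: sum.inter_restrict)
    also have "?I K \<inter> F K = F K"
      using F by blast
    also have "(\<Sum>i\<in>F K. 2 *\<^sub>R y i) = 2 *\<^sub>R sum y (F K)"
      by (simp add: scaleR_right.sum)
    finally have "2 * norm (sum y (F K)) < e"
      using K[of "N K" "N (Suc K)"] strict_mono_imp_increasing[OF N(2), of K] by simp
    then show False
      using big[of K] e by simp
  qed
qed

lemma unconditionally_convergent_iff_all_signs:
  "unconditionally_convergent y \<longleftrightarrow>
     (\<forall>\<theta>\<in>space sign_measure. summable (\<lambda>n. \<theta> n *\<^sub>R y n))"
  by (simp add: unconditionally_convergent_iff_summable_on all_signs_summable_iff_summable_on)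

section \<open>Random signs\<close>

lemma measurable_sign_translate:
  assumes "\<theta> \<in> space sign_measure"
  shows "(\<lambda>\<epsilon> n. \<theta> n * \<epsilon> n) \<in> sign_measure \<rightarrow>\<^sub>M sign_measure"
proof -
  let ?U = "uniform_count_measure {-1, 1::real}"
  have \<theta>: "\<theta> n = -1 \<or> \<theta> n = 1" for n
    using assms by (auto simp: space_sign_measure)
  have factor: "(\<lambda>s. \<theta> n * s) \<in> ?U \<rightarrow>\<^sub>M ?U" for n
    using \<theta>[of n]
    by (auto simp: measurable_def space_uniform_count_measure sets_uniform_count_measure)
  show ?thesis
    unfolding sign_measure_def
  proof (rule measurable_PiM_single')
    show "(\<lambda>\<epsilon>. \<theta> n * \<epsilon> n) \<in> (\<Pi>\<^sub>M n\<in>UNIV. ?U) \<rightarrow>\<^sub>M ?U" for n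
      by (rule measurable_compose[OF _ factor]) simp
    show "(\<lambda>\<epsilon> n. \<theta> n * \<epsilon> n) \<in> space (\<Pi>\<^sub>M n\<in>UNIV. ?U) \<rightarrow> (\<Pi>\<^sub>E n\<in>UNIV. space ?U)"
      using measurable_space[OF factor] by (auto simp: space_PiM PiE_iff)
  qed
qed

text \<open>
  Almost every \<open>\<epsilon>\<close> makes \<open>\<Sum>\<epsilon>\<^sub>n y\<^sub>n\<close> converge, and the translate \<open>\<theta>\<epsilon>\<close> of a random
  sign sequence has the distribution of \<open>\<epsilon>\<close>, so almost every \<open>\<theta>\<epsilon>\<close> does so too.
\<close>

lemma randomly_unconditionally_convergent_sign_change:
  assumes \<theta>: "\<theta> \<in> space sign_measure"
    and y: "randomly_unconditionally_convergent y"
  shows "randomly_unconditionally_convergent (\<lambda>n. \<theta> n *\<^sub>R y n)"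
proof -
  have "AE \<epsilon> in distr sign_measure sign_measure (\<lambda>\<epsilon> n. \<theta> n * \<epsilon> n).
          summable (\<lambda>n. \<epsilon> n *\<^sub>R y n)"
    using y unfolding distr_sign_measure_translate[OF \<theta>] randomly_unconditionally_convergent_def .
  then have "AE \<epsilon> in sign_measure. summable (\<lambda>n. (\<theta> n * \<epsilon> n) *\<^sub>R y n)"
    by (rule AE_distrD[OF measurable_sign_translate[OF \<theta>]])
  then show ?thesis
    by (simp add: randomly_unconditionally_convergent_def mult.commute)
qed

lemma randomly_unconditionally_convergent_imp_summable_signs:
  assumes "randomly_unconditionally_convergent y"
  obtains \<epsilon> where "\<epsilon> \<in> space sign_measure" "summable (\<lambda>n. \<epsilon> n *\<^sub>R y n)"
proof -
  interpret prob_space sign_measure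
    by (rule prob_space_sign_measure)
  have "\<exists>\<epsilon>. \<epsilon> \<in> space sign_measure \<and> summable (\<lambda>n. \<epsilon> n *\<^sub>R y n)"
  proof (rule ccontr)
    assume "\<nexists>\<epsilon>. \<epsilon> \<in> space sign_measure \<and> summable (\<lambda>n. \<epsilon> n *\<^sub>R y n)"
    then have "AE \<epsilon> in sign_measure. \<not> summable (\<lambda>n. \<epsilon> n *\<^sub>R y n)"
      by (intro AE_I2) simp
    with assms[unfolded randomly_unconditionally_convergent_def] show False
      by (rule AE_contr)
  qed
  with that show thesis
    by blast
qed

section \<open>Unconditional basic sequences\<close>

theorem proposition2p3:
  fixes smul :: "'k::real_normed_field \<Rightarrow> 'a::banach \<Rightarrow> 'a"
    and x :: "nat \<Rightarrow> 'a"
  assumes "banach_space_over smul"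
    and "basic_sequence smul x"
  shows "unconditional smul x \<longleftrightarrow> RUC smul x \<and> RUD smul x"
proof -
  interpret banach_space_over smul by fact
  \<comment> \<open>Signs are absorbed into the coefficients, so a change of signs is again a series in \<open>x\<close>.\<close>
  have smul_signs: "smul (of_real (\<theta> n) * a n) (x n) = \<theta> n *\<^sub>R smul (a n) (x n)" for \<theta> a n
    by (simp add: smul_of_real flip: scale_scale)
  show ?thesis
  proof (intro iffI conjI)
    assume U: "unconditional smul x"
    show "RUC smul x"
      using U unfolding RUC_def unconditional_def unconditionally_convergent_iff_all_signs
        randomly_unconditionally_convergent_def by (blast intro: AE_I2)
    show "RUD smul x"
      unfolding RUD_def
    proof (intro allI impI)
      fix a
      assume "randomly_unconditionally_convergent (\<lambda>n. smul (a n) (x n))"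
      then obtain \<epsilon> where \<epsilon>: "\<epsilon> \<in> space sign_measure"
        and sum: "summable (\<lambda>n. \<epsilon> n *\<^sub>R smul (a n) (x n))"
        by (rule randomly_unconditionally_convergent_imp_summable_signs)
      have "unconditionally_convergent (\<lambda>n. \<epsilon> n *\<^sub>R smul (a n) (x n))"
        using U[unfolded unconditional_def, rule_format, of "\<lambda>n. of_real (\<epsilon> n) * a n"] sum
        by (simp add: smul_signs)
      then have "summable (\<lambda>n. \<epsilon> n *\<^sub>R \<epsilon> n *\<^sub>R smul (a n) (x n))"
        using \<epsilon> by (simp add: unconditionally_convergent_iff_all_signs)
      moreover have "\<epsilon> n * \<epsilon> n = 1" for n
        using \<epsilon> by (auto simp: space_sign_measure dest: spec[of _ n])
      ultimately show "summable (\<lambda>n. smul (a n) (x n))"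
        by simp
    qed
  next
    assume R: "RUC smul x \<and> RUD smul x"
    show "unconditional smul x"
      unfolding unconditional_def unconditionally_convergent_iff_all_signs
    proof (intro allI impI ballI)
      fix a \<theta>
      assume sum: "summable (\<lambda>n. smul (a n) (x n))" and \<theta>: "\<theta> \<in> space sign_measure"
      have "randomly_unconditionally_convergent (\<lambda>n. \<theta> n *\<^sub>R smul (a n) (x n))"
        using R sum by (intro randomly_unconditionally_convergent_sign_change[OF \<theta>])
          (simp add: RUC_def)
      then show "summable (\<lambda>n. \<theta> n *\<^sub>R smul (a n) (x n))"
        using R[THEN conjunct2, unfolded RUD_def, rule_format, of "\<lambda>n. of_real (\<theta> n) * a n"]
        by (simp add: smul_signs)
    qed
  qed
qed

end
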